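(* Let $\mathcal{B}_0,\ldots,\mathcal{B}_{L-1}$ be a set of $L$ mutually unbiased bases of $\mathbb{C}^d$. Then for every unit vector $|\psi\rangle\in\mathbb{C}^d$, $$\frac{1}{L}\sum_{j=0}^{L-1}H_{\infty}(\mathcal{B}_{j}\,|\,|\psi\rangle) \;\geq\; -\log\left[\frac{1}{L}\left(1 + \frac{L-1}{\sqrt{d}}\right)\right].$$
   Context: Two orthonormal bases $\{|a\rangle\}$ and $\{|b\rangle\}$ of $\mathbb{C}^d$ are mutually unbiased if $|\langle a|b\rangle| = 1/\sqrt{d}$ for all $|a\rangle$, $|b\rangle$; a set of bases is mutually unbiased if every two distinct members are. For an orthonormal basis $\mathcal{B}=\{|b\rangle\}_b$ and a unit vector $|\psi\rangle$, the min-entropy is $H_\infty(\mathcal{B}\,|\,|\psi\rangle) = -\log \max_{b} |\langle b|\psi\rangle|^2$. Logarithms are base 2. *)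

theory Defs
  imports "HOL-Analysis.Analysis"
begin

text \<open>The Hermitian inner product is conjugate-linear in the first argument.  The library's
  \<open>\<bullet>\<close> on \<^typ>\<open>complex ^ 'd\<close> is real-valued (it is the real part of \<open>braket\<close>), so it cannot
  be used here; the library norm, however, is the one induced by \<open>braket\<close>
  (\<open>braket_self\<close>).\<close>

definition braket :: "complex ^ 'd \<Rightarrow> complex ^ 'd \<Rightarrow> complex" where
  "braket a b = (\<Sum>i\<in>UNIV. cnj (a $ i) * b $ i)"

lemma braket_self: "braket a a = complex_of_real ((norm a)\<^sup>2)"
  by (simp add: braket_def norm_vec_def L2_set_def sum_nonneg mult.commute
      flip: complex_norm_square)

text \<open>Independence and span are over \<^typ>\<open>complex\<close>: the \<open>vec\<close> versions use the
  scalar multiplication \<open>*s\<close> by complex numbers.\<close>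

definition orthonormal_basis :: "(complex ^ 'd) set \<Rightarrow> bool" where
  "orthonormal_basis B \<longleftrightarrow>
     vec.independent B \<and> vec.span B = UNIV \<and>
     (\<forall>a\<in>B. \<forall>b\<in>B. braket a b = (if a = b then 1 else 0))"

definition unbiased :: "(complex ^ 'd) set \<Rightarrow> (complex ^ 'd) set \<Rightarrow> bool" where
  "unbiased A B \<longleftrightarrow>
     (\<forall>a\<in>A. \<forall>b\<in>B. cmod (braket a b) = 1 / sqrt (real CARD('d)))"

definition mutually_unbiased_bases :: "(complex ^ 'd) set set \<Rightarrow> bool" where
  "mutually_unbiased_bases S \<longleftrightarrow>
     (\<forall>B\<in>S. orthonormal_basis B) \<and> pairwise unbiased S"

definition min_entropy :: "(complex ^ 'd) set \<Rightarrow> complex ^ 'd \<Rightarrow> real" where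
  "min_entropy B \<psi> = - log 2 (MAX b\<in>B. (cmod (braket b \<psi>))\<^sup>2)"

end

(* For maximisers b_j in each basis put c_j = <b_j|psi>, S = sum |c_j|^2 and phi = sum c_j b_j.
   Then S = <phi|psi>, so Cauchy-Schwarz gives S^2 <= |phi|^2, and the Gram matrix of the b_j has
   unit diagonal and off-diagonal entries of modulus 1/sqrt d, so |phi|^2 <= (1 + (L-1)/sqrt d) S.
   Hence S <= 1 + (L-1)/sqrt d, and concavity of the logarithm finishes the argument. *)
theory Submission
  imports Defs
begin

lemma braket_sum_left: "braket (\<Sum>i\<in>I. f i) b = (\<Sum>i\<in>I. braket (f i) b)"
  unfolding braket_def by (simp add: sum_distrib_right) (rule sum.swap)

lemma braket_sum_right: "braket a (\<Sum>i\<in>I. f i) = (\<Sum>i\<in>I. braket a (f i))"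
  unfolding braket_def by (simp add: sum_distrib_left) (rule sum.swap)

lemma braket_scale_left: "braket (c *s a) b = cnj c * braket a b"
  by (simp add: braket_def sum_distrib_left mult.assoc)

lemma braket_scale_right: "braket a (c *s b) = c * braket a b"
  by (simp add: braket_def sum_distrib_left algebra_simps)

lemma braket_add_left: "braket (a + b) c = braket a c + braket b c"
  by (simp add: braket_def sum.distrib algebra_simps)

text \<open>Gives access to Cauchy-Schwarz for the real inner product, which suffices once a
  \<open>braket\<close> is known to be real.\<close>

lemma Re_braket: "Re (braket a b) = a \<bullet> b"
  by (simp add: braket_def inner_vec_def inner_complex_def)

text \<open>If \<open>B\<close> were orthogonal to \<open>\<psi>\<close>, so would be its span,
  which contains \<open>\<psi>\<close> itself; then \<open>braket \<psi> \<psi>\<close> would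
  vanish.\<close>

lemma orthonormal_basis_nonorthogonal:
  assumes "orthonormal_basis B" and "\<psi> \<noteq> 0"
  shows "\<exists>b\<in>B. braket b \<psi> \<noteq> 0"
proof (rule ccontr)
  assume "\<not> ?thesis"
  then have orth: "braket b \<psi> = 0" if "b \<in> B" for b
    using that by blast
  have "\<psi> \<in> vec.span B"
    using assms(1) by (simp add: orthonormal_basis_def)
  \<comment> \<open>\<open>braket\<close> is conjugate-linear in \<open>x\<close>, but its zero set
    is still closed under complex scaling.\<close>
  moreover have "vec.subspace {x. braket x \<psi> = 0}"
    by (rule vec.subspaceI) (auto simp: braket_add_left braket_scale_left, simp add: braket_def)
  ultimately have "braket \<psi> \<psi> = 0"
    using orth by (elim vec.span_induct[where P = "\<lambda>x. braket x \<psi> = 0"]) auto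
  then show False
    using assms(2) by (simp add: braket_self)
qed

text \<open>The maximum is over a finite nonempty set, so some basis vector attains it. Positivity
  is recorded because the logarithm is convex or monotone only on positive arguments.\<close>

lemma min_entropy_attained:
  assumes B: "orthonormal_basis B" and "\<psi> \<noteq> 0"
  shows "\<exists>b\<in>B. 0 < (cmod (braket b \<psi>))\<^sup>2 \<and>
    min_entropy B \<psi> = - log 2 ((cmod (braket b \<psi>))\<^sup>2)"
proof -
  let ?p = "\<lambda>b. (cmod (braket b \<psi>))\<^sup>2"
  obtain b' where b': "b' \<in> B" "braket b' \<psi> \<noteq> 0"
    using orthonormal_basis_nonorthogonal[OF assms] by blast
  have fin: "finite B"
    using B vec.finiteI_independent by (auto simp: orthonormal_basis_def)
  then have "Max (?p ` B) \<in> ?p ` B"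
    using b'(1) by (intro Max_in) auto
  then obtain b where b: "b \<in> B" "Max (?p ` B) = ?p b"
    by blast
  have "0 < ?p b'"
    using b'(2) by simp
  also have "?p b' \<le> ?p b"
    using fin b'(1) b(2)[symmetric] by simp
  finally show ?thesis
    using b by (intro bexI[of _ b]) (auto simp: min_entropy_def)
qed

text \<open>Only the Gram matrix of the \<open>b j\<close> enters, so the bound is stated for unit
  vectors with pairwise overlaps at most \<open>\<delta>\<close>; unbiasedness later supplies
  \<open>\<delta>\<close> as \<open>1 / sqrt d\<close>.\<close>

lemma sum_cmod_braket_le:
  fixes b :: "nat \<Rightarrow> complex ^ 'd"
  assumes L: "L \<ge> 1" and unit: "\<And>j. j < L \<Longrightarrow> braket (b j) (b j) = 1"
    and overlap: "\<And>i j. i < L \<Longrightarrow> j < L \<Longrightarrow> i \<noteq> j \<Longrightarrow> cmod (braket (b i) (b j)) \<le> \<delta>"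
    and "\<delta> \<ge> 0" and "norm \<psi> = 1"
  shows "(\<Sum>j<L. (cmod (braket (b j) \<psi>))\<^sup>2) \<le> 1 + (real L - 1) * \<delta>"
proof -
  define c where "c j = braket (b j) \<psi>" for j
  define S where "S = (\<Sum>j<L. (cmod (c j))\<^sup>2)"
  define \<phi> where "\<phi> = (\<Sum>j<L. c j *s b j)"
  have S0: "S \<ge> 0"
    by (simp add: S_def sum_nonneg)
  have "braket \<phi> \<psi> = of_real S"
    by (simp add: \<phi>_def S_def braket_sum_left braket_scale_left mult.commute
        flip: c_def complex_norm_square)
  then have "S = \<phi> \<bullet> \<psi>"
    by (simp flip: Re_braket)
  also have "\<dots> \<le> norm \<phi>"
    using norm_cauchy_schwarz[of \<phi> \<psi>] assms(5) by simp
  finally have "S\<^sup>2 \<le> (norm \<phi>)\<^sup>2"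
    using S0 by (simp add: power_mono)
  also have "\<dots> = cmod (braket \<phi> \<phi>)"
    by (simp add: braket_self norm_power)
  also have "braket \<phi> \<phi> = (\<Sum>i<L. \<Sum>j<L. cnj (c i) * c j * braket (b i) (b j))"
    by (simp add: \<phi>_def braket_sum_left braket_sum_right braket_scale_left braket_scale_right
        sum_distrib_left mult.assoc)
      (subst sum.swap, simp add: mult.left_commute)
  also have "cmod \<dots> \<le> (\<Sum>i<L. \<Sum>j<L. cmod (c i) * cmod (c j) * cmod (braket (b i) (b j)))"
    by (intro sum_norm_le) (simp add: norm_mult)
  \<comment> \<open>AM-GM replaces each product by a mean of squares, which separates the indices so
    that the double sum can be evaluated in terms of \<open>S\<close>.\<close>
  also have "\<dots> \<le> (\<Sum>i<L. \<Sum>j<L. ((cmod (c i))\<^sup>2 + (cmod (c j))\<^sup>2) / 2 * (if i = j then 1 else \<delta>))"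
  proof (intro sum_mono mult_mono)
    fix i j
    show "cmod (c i) * cmod (c j) \<le> ((cmod (c i))\<^sup>2 + (cmod (c j))\<^sup>2) / 2"
      using sum_squares_bound[of "cmod (c i)" "cmod (c j)"] by simp
  qed (use unit overlap in auto)
  \<comment> \<open>The weight is split into \<open>\<delta>\<close> on all pairs plus a correction
    \<open>1 - \<delta>\<close> on the diagonal.\<close>
  also have "\<dots> = (\<Sum>i<L. \<Sum>j<L. \<delta> * ((cmod (c i))\<^sup>2 + (cmod (c j))\<^sup>2) / 2
      + (if i = j then (1 - \<delta>) * (cmod (c i))\<^sup>2 else 0))"
    by (intro sum.cong) (auto simp: field_simps)
  also have "\<dots> = (\<Sum>i<L. (\<delta> * real L / 2 + (1 - \<delta>)) * (cmod (c i))\<^sup>2 + \<delta> / 2 * S)"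
    by (intro sum.cong refl)
      (simp add: S_def sum.distrib algebra_simps add_divide_distrib
        flip: sum_distrib_left sum_divide_distrib)
  also have "\<dots> = (\<delta> * real L / 2 + (1 - \<delta>)) * S + real L * (\<delta> / 2 * S)"
    by (simp add: S_def sum.distrib sum_distrib_left)
  also have "\<dots> = (1 + (real L - 1) * \<delta>) * S"
    by (simp add: field_simps)
  finally have "S * S \<le> (1 + (real L - 1) * \<delta>) * S"
    by (simp add: power2_eq_square)
  \<comment> \<open>Settles the case \<open>S = 0\<close>, where the factor \<open>S\<close> cannot
    be cancelled.\<close>
  moreover have "0 \<le> 1 + (real L - 1) * \<delta>"
    using L assms(4) by simp
  ultimately have "S \<le> 1 + (real L - 1) * \<delta>"
    using S0 by (cases "S = 0") (auto simp: mult_le_cancel_right)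
  then show ?thesis
    by (simp add: S_def c_def)
qed

theorem mainTheorem2:
  fixes \<B> :: "nat \<Rightarrow> (complex ^ 'd) set"
    and L :: nat
    and \<psi> :: "complex ^ 'd"
  assumes "L \<ge> 1"
    and "inj_on \<B> {..<L}"
    and "mutually_unbiased_bases (\<B> ` {..<L})"
    and "norm \<psi> = 1"
  shows "1 / real L * (\<Sum>j<L. min_entropy (\<B> j) \<psi>)
           \<ge> - log 2 (1 / real L * (1 + (real L - 1) / sqrt (real CARD('d))))"
proof -
  have onb: "orthonormal_basis (\<B> j)" if "j < L" for j
    using assms(3) that by (auto simp: mutually_unbiased_bases_def)
  have unb: "unbiased (\<B> i) (\<B> j)" if "i < L" "j < L" "i \<noteq> j" for i j
  proof -
    \<comment> \<open>\<open>pairwise\<close> constrains only distinct members of the set of bases;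
      injectivity makes distinct indices give distinct bases.\<close>
    have "\<B> i \<noteq> \<B> j"
      using assms(2) that by (auto dest: inj_onD)
    then show ?thesis
      using assms(3) that by (auto simp: mutually_unbiased_bases_def pairwise_def)
  qed
  have "\<psi> \<noteq> 0"
    using assms(4) by auto
  \<comment> \<open>With \<open>j < L\<close> inside the existential, choice yields a single
    function \<open>b\<close> selecting a maximiser in each basis.\<close>
  then have "\<forall>j. \<exists>b. j < L \<longrightarrow> b \<in> \<B> j \<and> 0 < (cmod (braket b \<psi>))\<^sup>2 \<and>
      min_entropy (\<B> j) \<psi> = - log 2 ((cmod (braket b \<psi>))\<^sup>2)"
    using onb min_entropy_attained by blast
  then obtain b where mem: "\<And>j. j < L \<Longrightarrow> b j \<in> \<B> j"
    and pos: "\<And>j. j < L \<Longrightarrow> 0 < (cmod (braket (b j) \<psi>))\<^sup>2"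
    and ent: "\<And>j. j < L \<Longrightarrow> min_entropy (\<B> j) \<psi> = - log 2 ((cmod (braket (b j) \<psi>))\<^sup>2)"
    by metis
  define p where "p j = (cmod (braket (b j) \<psi>))\<^sup>2" for j
  have p0: "p j > 0" if "j < L" for j
    using pos[OF that] by (simp add: p_def)
  have "(\<Sum>j<L. p j) \<le> 1 + (real L - 1) * (1 / sqrt (real CARD('d)))"
    unfolding p_def
  proof (rule sum_cmod_braket_le)
    show "braket (b j) (b j) = 1" if "j < L" for j
      using onb[OF that] mem[OF that] by (simp add: orthonormal_basis_def)
    show "cmod (braket (b i) (b j)) \<le> 1 / sqrt (real CARD('d))" if "i < L" "j < L" "i \<noteq> j" for i j
      using unb[OF that] mem that by (simp add: unbiased_def)
  qed (use assms in auto)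
  then have "1 / real L * (\<Sum>j<L. p j) \<le> 1 / real L * (1 + (real L - 1) / sqrt (real CARD('d)))"
    by (intro mult_left_mono) auto
  moreover have "0 < 1 / real L * (\<Sum>j<L. p j)"
    using assms(1) p0 by (auto intro!: divide_pos_pos sum_pos simp: lessThan_empty_iff)
  ultimately have "- log 2 (1 / real L * (1 + (real L - 1) / sqrt (real CARD('d))))
      \<le> - log 2 (1 / real L * (\<Sum>j<L. p j))"
    by simp
  \<comment> \<open>Jensen's inequality for the convex function \<open>- log 2\<close> on the
    positive reals, with uniform weights \<open>1 / L\<close>.\<close>
  also have "\<dots> \<le> (\<Sum>j<L. 1 / real L * - log 2 (p j))"
    using convex_on_sum[OF _ _ minus_log_convex, of "{..<L}" 2 "\<lambda>_. 1 / real L" p] assms(1) p0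
    by (auto simp: sum_divide_distrib lessThan_empty_iff)
  also have "\<dots> = 1 / real L * (\<Sum>j<L. min_entropy (\<B> j) \<psi>)"
    by (simp add: sum_distrib_left ent p_def)
  finally show ?thesis .
qed

end
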